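(* Let $p$ be a prime and let $\mathcal{F}$ be a saturated fusion system on a finite $p$-group $P$. If $\mathcal{F}$ is perfect then $Z_2(\mathcal{F})=Z(\mathcal{F})$.
   Context: Fusion systems and saturated fusion systems on finite $p$-groups are as usual: $\mathcal F$ is a category whose objects are the subgroups of $P$ and whose morphisms are injective homomorphisms, including all conjugations by elements of $P$. Maps are written on the right. For a finite group $G$ with Sylow $p$-subgroup $P$, $\mathcal{F}_P(G)$ is the fusion system on $P$ whose morphisms are all conjugation maps between subgroups of $P$ induced by elements of $G$. A morphism of fusion systems from $\mathcal{F}$ on $P$ to $\mathcal{E}$ on $A$ is a group homomorphism $\theta:P\to A$ such that for every morphism $\phi:Q\to R$ in $\mathcal{F}$ there is a morphism $\psi:Q\theta\to R\theta$ in $\mathcal{E}$ with $(x\phi)\theta=(x\theta)\psi$ for all $x\in Q$. A saturated fusion system $\mathcal{F}$ is perfect if there is no surjective morphism $\mathcal{F}\to\mathcal{F}_A(A)$ for any non-trivial abelian $p$-group $A$. A subgroup $T\le P$ is strongly $\mathcal{F}$-closed if $Q\phi\le T$ for every $Q\le T$ and every morphism $\phi:Q\to P$ in $\mathcal{F}$. For such $T$, $\mathcal{F}/T$ is the fusion system on $P/T$ whose morphisms $Q/T\to R/T$ (for $T\le Q,R\le P$) are those induced by morphisms $Q\to R$ in $\mathcal{F}$. The centre $Z(\mathcal{F})$ is the set of all $x\in P$ such that every morphism $\phi:Q\to R$ in $\mathcal{F}$ has an extension $\bar\phi:Q\langle x\rangle\to R\langle x\rangle$ in $\mathcal{F}$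 with $x\bar\phi=x$. $Z_2(\mathcal{F})$ is the preimage in $P$ of $Z(\mathcal{F}/Z(\mathcal{F}))$. *)

theory Defs
  imports "HOL-Algebra.Algebra" "HOL-Computational_Algebra.Primes"
begin

section \<open>Groups\<close>

definition finite_p_group :: "nat \<Rightarrow> ('a, 'm) monoid_scheme \<Rightarrow> bool" where
  "finite_p_group p G \<longleftrightarrow> group G \<and> finite (carrier G) \<and> (\<exists>n. order G = p ^ n)"

definition sylow_subgroup :: "nat \<Rightarrow> 'a set \<Rightarrow> ('a, 'm) monoid_scheme \<Rightarrow> bool" where
  "sylow_subgroup p S G \<longleftrightarrow> finite (carrier G) \<and> subgroup S G \<and> card S = p ^ multiplicity p (order G)"

definition conj_by :: "('a, 'm) monoid_scheme \<Rightarrow> 'a \<Rightarrow> 'a \<Rightarrow> 'a" where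
  "conj_by G g x = inv\<^bsub>G\<^esub> g \<otimes>\<^bsub>G\<^esub> x \<otimes>\<^bsub>G\<^esub> g"

section \<open>Fusion systems\<close>

text \<open>
  A fusion system on \<open>P\<close> is given by its sets of morphisms \<open>F Q R\<close>, where \<open>Q\<close> and \<open>R\<close> range over
  the subgroups of \<open>P\<close>; the values of \<open>F\<close> at other sets are irrelevant. A morphism \<open>Q \<rightarrow> R\<close> is
  an \<^emph>\<open>extensional\<close> function on \<open>Q\<close> (\<open>undefined\<close> outside \<open>Q\<close>), so that equality of functions is
  equality of maps on \<open>Q\<close>. Functions are applied on the left, but conjugation by \<open>g\<close> is
  \<open>x \<mapsto> g\<inverse> x g\<close>, as for maps written on the right.
\<close>

text \<open>
  The morphisms of \<open>\<F>\<^sub>P(G)\<close>. They depend on \<open>P\<close> only through the range of the objects \<open>Q\<close>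
  and \<open>R\<close>.
\<close>
definition group_fusion :: "('a, 'm) monoid_scheme \<Rightarrow> 'a set \<Rightarrow> 'a set \<Rightarrow> ('a \<Rightarrow> 'a) set" where
  "group_fusion G Q R = {restrict (conj_by G g) Q | g. g \<in> carrier G \<and> conj_by G g ` Q \<subseteq> R}"

text \<open>
  By \<open>conj_morphism\<close>, \<open>F\<close> contains all inclusions and in particular the identities; with
  \<open>comp_morphism\<close> it is therefore closed under restriction.
\<close>
locale fusion_system =
  fixes p :: nat and P :: "('a, 'm) monoid_scheme" (structure)
    and F :: "'a set \<Rightarrow> 'a set \<Rightarrow> ('a \<Rightarrow> 'a) set"
  assumes p_group: "finite_p_group p P"
    and morphism:
      "\<lbrakk>subgroup Q P; subgroup R P; \<phi> \<in> F Q R\<rbrakk>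
        \<Longrightarrow> \<phi> \<in> extensional Q \<and> \<phi> \<in> hom (P\<lparr>carrier := Q\<rparr>) (P\<lparr>carrier := R\<rparr>) \<and> inj_on \<phi> Q"
    and conj_morphism:
      "\<lbrakk>subgroup Q P; subgroup R P\<rbrakk> \<Longrightarrow> group_fusion P Q R \<subseteq> F Q R"
    and comp_morphism:
      "\<lbrakk>subgroup Q P; subgroup R P; subgroup S P; \<phi> \<in> F Q R; \<psi> \<in> F R S\<rbrakk>
        \<Longrightarrow> compose Q \<psi> \<phi> \<in> F Q S"
    and image_morphism:
      "\<lbrakk>subgroup Q P; subgroup R P; \<phi> \<in> F Q R\<rbrakk> \<Longrightarrow> \<phi> \<in> F Q (\<phi> ` Q)"
    and inverse_morphism:
      "\<lbrakk>subgroup Q P; subgroup R P; \<phi> \<in> F Q R\<rbrakk>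
        \<Longrightarrow> restrict (inv_into Q \<phi>) (\<phi> ` Q) \<in> F (\<phi> ` Q) Q"

text \<open>
  The group \<open>Aut\<^sub>\<F>(Q)\<close>. The multiplication of \<^const>\<open>BijGroup\<close> is composition of maps written on
  the left; for maps on the right one obtains the opposite group, which has the same subgroups.
\<close>
definition Aut_fusion :: "('a set \<Rightarrow> 'a set \<Rightarrow> ('a \<Rightarrow> 'a) set) \<Rightarrow> 'a set \<Rightarrow> ('a \<Rightarrow> 'a) monoid" where
  "Aut_fusion F Q = BijGroup Q\<lparr>carrier := F Q Q\<rparr>"

definition fully_automized ::
  "nat \<Rightarrow> ('a, 'm) monoid_scheme \<Rightarrow> ('a set \<Rightarrow> 'a set \<Rightarrow> ('a \<Rightarrow> 'a) set) \<Rightarrow> 'a set \<Rightarrow> bool" where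
  "fully_automized p P F Q \<longleftrightarrow> sylow_subgroup p (group_fusion P Q Q) (Aut_fusion F Q)"

text \<open>
  For an isomorphism \<open>\<phi> : R \<rightarrow> Q\<close>, the subgroup \<open>N\<^sub>\<phi>\<close> of those \<open>g \<in> N\<^sub>P(R)\<close> for which conjugation
  by \<open>g\<close> on \<open>R\<close> is carried by \<open>\<phi>\<close> to conjugation by an element of \<open>N\<^sub>P(Q)\<close>.
\<close>
definition N_phi :: "('a, 'm) monoid_scheme \<Rightarrow> 'a set \<Rightarrow> 'a set \<Rightarrow> ('a \<Rightarrow> 'a) \<Rightarrow> 'a set" where
  "N_phi P R Q \<phi> =
    {g \<in> normalizer P R. \<exists>h \<in> normalizer P Q. \<forall>y\<in>R. \<phi> (conj_by P g y) = conj_by P h (\<phi> y)}"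

definition receptive ::
  "('a, 'm) monoid_scheme \<Rightarrow> ('a set \<Rightarrow> 'a set \<Rightarrow> ('a \<Rightarrow> 'a) set) \<Rightarrow> 'a set \<Rightarrow> bool" where
  "receptive P F Q \<longleftrightarrow>
    (\<forall>R \<phi>. subgroup R P \<and> \<phi> \<in> F R Q \<and> \<phi> ` R = Q \<longrightarrow>
      (\<exists>\<psi> \<in> F (N_phi P R Q \<phi>) (carrier P). \<forall>y\<in>R. \<psi> y = \<phi> y))"

locale saturated_fusion_system = fusion_system +
  assumes saturated:
    "subgroup Q P \<Longrightarrow>
      \<exists>R. subgroup R P \<and> (\<exists>\<phi> \<in> F Q R. \<phi> ` Q = R) \<and> fully_automized p P F R \<and> receptive P F R"

section \<open>Morphisms and perfect fusion systems\<close>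

definition fusion_morphism ::
  "('a, 'm) monoid_scheme \<Rightarrow> ('a set \<Rightarrow> 'a set \<Rightarrow> ('a \<Rightarrow> 'a) set) \<Rightarrow>
   ('b, 'n) monoid_scheme \<Rightarrow> ('b set \<Rightarrow> 'b set \<Rightarrow> ('b \<Rightarrow> 'b) set) \<Rightarrow> ('a \<Rightarrow> 'b) \<Rightarrow> bool" where
  "fusion_morphism P F A E \<theta> \<longleftrightarrow>
    \<theta> \<in> hom P A \<and>
    (\<forall>Q R \<phi>. subgroup Q P \<and> subgroup R P \<and> \<phi> \<in> F Q R \<longrightarrow>
      (\<exists>\<psi> \<in> E (\<theta> ` Q) (\<theta> ` R). \<forall>x\<in>Q. \<theta> (\<phi> x) = \<psi> (\<theta> x)))"

text \<open>
  The groups \<open>A\<close> have their elements in the type of \<open>P\<close>. This is no restriction, since the image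
  of a morphism has at most \<open>|P|\<close> elements: see \<open>perfect_fusionD\<close> below.
\<close>
definition perfect_fusion ::
  "nat \<Rightarrow> ('a, 'm) monoid_scheme \<Rightarrow> ('a set \<Rightarrow> 'a set \<Rightarrow> ('a \<Rightarrow> 'a) set) \<Rightarrow> bool" where
  "perfect_fusion p P F \<longleftrightarrow>
    \<not> (\<exists>(A :: 'a monoid) \<theta>. comm_group A \<and> finite_p_group p A \<and> carrier A \<noteq> {\<one>\<^bsub>A\<^esub>} \<and>
         fusion_morphism P F A (group_fusion A) \<theta> \<and> \<theta> ` carrier P = carrier A)"

lemma perfect_fusionD:
  fixes A :: "('b, 'n) monoid_scheme"
  assumes perfect: "perfect_fusion p P F"
    and A: "comm_group A" "finite_p_group p A" "carrier A \<noteq> {\<one>\<^bsub>A\<^esub>}"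
    and \<theta>: "fusion_morphism P F A (group_fusion A) \<theta>"
  shows "\<theta> ` carrier P \<noteq> carrier A"
proof
  assume surj: "\<theta> ` carrier P = carrier A"
  interpret A: comm_group A by (fact A)
  have hom: "\<theta> \<in> hom P A" using \<theta> by (simp add: fusion_morphism_def)
  define s where "s = inv_into (carrier P) \<theta>"
  have \<theta>s: "\<theta> (s a) = a" if "a \<in> carrier A" for a
    unfolding s_def using that surj by (simp add: f_inv_into_f)
  define B where "B = \<lparr>carrier = s ` carrier A, monoid.mult = (\<lambda>x y. s (\<theta> x \<otimes>\<^bsub>A\<^esub> \<theta> y)), one = s \<one>\<^bsub>A\<^esub>\<rparr>"
  have inj: "inj_on s (carrier A)" by (rule inj_on_inverseI[of _ \<theta>]) (simp add: \<theta>s)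
  have s_hom: "s \<in> hom A B" by (auto simp: hom_def B_def \<theta>s)
  have iso: "s \<in> iso A B" using s_hom inj by (auto simp: iso_def bij_betw_def B_def)
  have B_one: "B\<lparr>one := s \<one>\<^bsub>A\<^esub>\<rparr> = B" unfolding B_def by simp
  have "comm_group (B\<lparr>one := s \<one>\<^bsub>A\<^esub>\<rparr>)" by (rule A.iso_imp_img_comm_group[OF iso])
  then have comm: "comm_group B" unfolding B_one .
  interpret B: comm_group B by (fact comm)
  have "group_hom A B s"
    using A.group_axioms B.group_axioms s_hom by (simp add: group_hom_def group_hom_axioms_def)
  note s_mult = group_hom.hom_mult[OF this] and s_inv = group_hom.hom_inv[OF this]
  have carB: "carrier B = s ` carrier A" by (simp add: B_def)
  have card: "card (carrier B) = card (carrier A)" unfolding carB by (rule card_image[OF inj])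
  have "finite_p_group p B"
    using A(2) card by (auto simp: finite_p_group_def order_def carB intro: B.group_axioms)
  moreover have "carrier B \<noteq> {\<one>\<^bsub>B\<^esub>}"
  proof -
    obtain a where a: "a \<in> carrier A" "a \<noteq> \<one>\<^bsub>A\<^esub>" using A(3) A.one_closed by blast
    then have "s a \<noteq> s \<one>\<^bsub>A\<^esub>" using inj A.one_closed by (auto dest: inj_onD)
    then have "s a \<noteq> \<one>\<^bsub>B\<^esub>" by (simp add: B_def)
    with a show ?thesis by (auto simp: carB)
  qed
  moreover have "fusion_morphism P F B (group_fusion B) (s \<circ> \<theta>)"
    unfolding fusion_morphism_def
  proof (intro conjI allI impI)
    show "s \<circ> \<theta> \<in> hom P B" using hom s_hom by (rule Group.hom_compose)
    fix Q R \<phi> assume QR: "subgroup Q P \<and> subgroup R P \<and> \<phi> \<in> F Q R"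
    then obtain \<psi> where \<psi>: "\<psi> \<in> group_fusion A (\<theta> ` Q) (\<theta> ` R)" "\<forall>x\<in>Q. \<theta> (\<phi> x) = \<psi> (\<theta> x)"
      using \<theta> unfolding fusion_morphism_def by blast
    then obtain g where g: "g \<in> carrier A" "conj_by A g ` \<theta> ` Q \<subseteq> \<theta> ` R"
      "\<psi> = restrict (conj_by A g) (\<theta> ` Q)"
      by (auto simp: group_fusion_def)
    have \<theta>Q: "\<theta> x \<in> carrier A" if "x \<in> Q" for x
      using that QR hom subgroup.mem_carrier unfolding hom_def by fastforce
    have conj: "s (conj_by A g (\<theta> x)) = conj_by B (s g) (s (\<theta> x))" if "x \<in> Q" for x
      using \<theta>Q[OF that] g(1) by (simp add: conj_by_def s_mult s_inv)
    have "restrict (conj_by B (s g)) ((s \<circ> \<theta>) ` Q) \<in> group_fusion B ((s \<circ> \<theta>) ` Q) ((s \<circ> \<theta>) ` R)"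
      unfolding group_fusion_def
    proof (intro CollectI exI conjI)
      show "s g \<in> carrier B" using g(1) by (simp add: carB)
      show "conj_by B (s g) ` (s \<circ> \<theta>) ` Q \<subseteq> (s \<circ> \<theta>) ` R"
      proof clarify
        fix x assume x: "x \<in> Q"
        then have "conj_by A g (\<theta> x) \<in> \<theta> ` R" using g(2) by auto
        with x show "conj_by B (s g) ((s \<circ> \<theta>) x) \<in> (s \<circ> \<theta>) ` R"
          by (auto simp: conj[symmetric])
      qed
    qed (rule refl)
    moreover have "\<forall>x\<in>Q. (s \<circ> \<theta>) (\<phi> x) = restrict (conj_by B (s g)) ((s \<circ> \<theta>) ` Q) ((s \<circ> \<theta>) x)"
      using \<psi>(2) g(3) by (auto simp: conj)
    ultimately show "\<exists>\<psi> \<in> group_fusion B ((s \<circ> \<theta>) ` Q) ((s \<circ> \<theta>) ` R).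
        \<forall>x\<in>Q. (s \<circ> \<theta>) (\<phi> x) = \<psi> ((s \<circ> \<theta>) x)" by blast
  qed
  moreover have "(s \<circ> \<theta>) ` carrier P = carrier B"
    by (simp only: image_comp[symmetric] surj carB)
  ultimately show False using perfect comm unfolding perfect_fusion_def by blast
qed

section \<open>Quotients and the centre\<close>

definition strongly_closed ::
  "('a, 'm) monoid_scheme \<Rightarrow> ('a set \<Rightarrow> 'a set \<Rightarrow> ('a \<Rightarrow> 'a) set) \<Rightarrow> 'a set \<Rightarrow> bool" where
  "strongly_closed P F T \<longleftrightarrow>
    subgroup T P \<and> (\<forall>Q \<phi>. subgroup Q P \<and> Q \<subseteq> T \<and> \<phi> \<in> F Q (carrier P) \<longrightarrow> \<phi> ` Q \<subseteq> T)"

text \<open>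
  The morphisms of \<open>\<F>/T\<close> on \<^term>\<open>P Mod T\<close>, for strongly closed \<open>T\<close>. The subgroup \<open>Q/T\<close> is the
  set of cosets \<^term>\<open>(\<lambda>x. T #>\<^bsub>P\<^esub> x) ` Q\<close>.
\<close>
definition quotient_fusion ::
  "('a, 'm) monoid_scheme \<Rightarrow> ('a set \<Rightarrow> 'a set \<Rightarrow> ('a \<Rightarrow> 'a) set) \<Rightarrow> 'a set \<Rightarrow>
   'a set set \<Rightarrow> 'a set set \<Rightarrow> ('a set \<Rightarrow> 'a set) set" where
  "quotient_fusion P F T Q' R' =
    {\<psi> \<in> extensional Q'. \<exists>Q R \<phi>. subgroup Q P \<and> subgroup R P \<and> T \<subseteq> Q \<and> T \<subseteq> R \<and>
       Q' = (\<lambda>x. T #>\<^bsub>P\<^esub> x) ` Q \<and> R' = (\<lambda>x. T #>\<^bsub>P\<^esub> x) ` R \<and>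
       \<phi> \<in> F Q R \<and> (\<forall>x\<in>Q. \<psi> (T #>\<^bsub>P\<^esub> x) = T #>\<^bsub>P\<^esub> \<phi> x)}"

text \<open>
  \<open>Q\<langle>x\<rangle>\<close> is rendered as the subgroup generated by \<open>Q\<close> and \<open>x\<close>. It agrees with the product set
  for the elements in question: conjugations being morphisms \<open>P \<rightarrow> P\<close>, the condition forces \<open>x\<close>
  to be central in \<open>P\<close>.
\<close>
definition fusion_centre ::
  "('a, 'm) monoid_scheme \<Rightarrow> ('a set \<Rightarrow> 'a set \<Rightarrow> ('a \<Rightarrow> 'a) set) \<Rightarrow> 'a set" where
  "fusion_centre P F =
    {x \<in> carrier P. \<forall>Q R \<phi>. subgroup Q P \<and> subgroup R P \<and> \<phi> \<in> F Q R \<longrightarrow>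
       (\<exists>\<psi> \<in> F (generate P (insert x Q)) (generate P (insert x R)).
          (\<forall>y\<in>Q. \<psi> y = \<phi> y) \<and> \<psi> x = x)}"

text \<open>The centre is strongly closed and normal, so that \<open>\<F>/Z(\<F>)\<close> is meaningful.\<close>

context fusion_system
begin

lemma group_P: "group P"
  using p_group by (simp add: finite_p_group_def)

sublocale group P by (fact group_P)

lemma inclusion_morphism:
  assumes "subgroup Q P" "subgroup R P" "Q \<subseteq> R"
  shows "(\<lambda>x\<in>Q. x) \<in> F Q R"
proof -
  have c: "conj_by P \<one> x = x" if "x \<in> Q" for x
    using that assms(1) by (simp add: conj_by_def subgroup.mem_carrier)
  have "restrict (conj_by P \<one>) Q \<in> group_fusion P Q R"
    unfolding group_fusion_def using assms(3) c by force
  moreover have "restrict (conj_by P \<one>) Q = (\<lambda>x\<in>Q. x)"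
    by (rule restrict_ext) (fact c)
  ultimately show ?thesis using conj_morphism[OF assms(1,2)] by auto
qed

lemma fusion_centre_carrier: "x \<in> fusion_centre P F \<Longrightarrow> x \<in> carrier P"
  by (simp add: fusion_centre_def)

lemma fusion_centre_extend:
  assumes "x \<in> fusion_centre P F" "subgroup Q P" "subgroup R P" "\<phi> \<in> F Q R"
  obtains \<psi> where "\<psi> \<in> F (generate P (insert x Q)) (generate P (insert x R))"
    "\<And>y. y \<in> Q \<Longrightarrow> \<psi> y = \<phi> y" "\<psi> x = x"
  using assms unfolding fusion_centre_def by blast

lemma fusion_centre_fixed:
  assumes "x \<in> fusion_centre P F" "subgroup Q P" "subgroup R P" "\<phi> \<in> F Q R" "x \<in> Q"
  shows "\<phi> x = x"
  using fusion_centre_extend[OF assms(1-4)] assms(5) by metis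

lemma fusion_centre_generate:
  assumes xy: "x \<in> fusion_centre P F" "y \<in> fusion_centre P F" and z: "z \<in> generate P {x, y}"
  shows "z \<in> fusion_centre P F"
  unfolding fusion_centre_def
proof (intro CollectI conjI allI impI)
  have xyP: "{x, y} \<subseteq> carrier P" using xy by (simp add: fusion_centre_carrier)
  show zP: "z \<in> carrier P" using generate_in_carrier[OF xyP z] .
  fix Q R \<phi> assume "subgroup Q P \<and> subgroup R P \<and> \<phi> \<in> F Q R"
  then have Q: "subgroup Q P" and R: "subgroup R P" and \<phi>: "\<phi> \<in> F Q R" by auto
  have gen: "subgroup (generate P (insert w S)) P" if "subgroup S P" "w \<in> carrier P" for w S
    by (rule generate_is_subgroup) (use that subgroup.subset in auto)
  define Q1 R1 where "Q1 = generate P (insert x Q)" and "R1 = generate P (insert x R)"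
  define Q2 R2 where "Q2 = generate P (insert y Q1)" and "R2 = generate P (insert y R1)"
  define Q3 R3 where "Q3 = generate P (insert z Q)" and "R3 = generate P (insert z R)"
  have sub: "subgroup Q1 P" "subgroup R1 P" "subgroup Q2 P" "subgroup R2 P"
    "subgroup Q3 P" "subgroup R3 P"
    using Q R xyP zP by (auto simp: Q1_def R1_def Q2_def R2_def Q3_def R3_def intro!: gen)
  obtain \<psi>1 where \<psi>1: "\<psi>1 \<in> F Q1 R1" "\<And>v. v \<in> Q \<Longrightarrow> \<psi>1 v = \<phi> v" "\<psi>1 x = x"
    using fusion_centre_extend[OF xy(1) Q R \<phi>] unfolding Q1_def R1_def by blast
  obtain \<psi> where \<psi>: "\<psi> \<in> F Q2 R2" "\<And>v. v \<in> Q1 \<Longrightarrow> \<psi> v = \<psi>1 v" "\<psi> y = y"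
    using fusion_centre_extend[OF xy(2) sub(1,2) \<psi>1(1)] unfolding Q2_def R2_def by blast
  have QQ1: "insert x Q \<subseteq> Q1" and QQ2: "insert y Q1 \<subseteq> Q2"
    unfolding Q1_def Q2_def by (auto intro: generate.incl)
  have ext: "\<psi> v = \<phi> v" if "v \<in> Q" for v using that QQ1 \<psi>1(2) \<psi>(2) by auto
  have \<psi>x: "\<psi> x = x" using QQ1 \<psi>1(3) \<psi>(2) by auto
  interpret h: group_hom "P\<lparr>carrier := Q2\<rparr>" "P\<lparr>carrier := R2\<rparr>" \<psi>
    using morphism[OF sub(3,4) \<psi>(1)] subgroup_imp_group[OF sub(3)] subgroup_imp_group[OF sub(4)]
    by (simp add: group_hom_def group_hom_axioms_def)
  have h_mult: "\<psi> (u \<otimes> v) = \<psi> u \<otimes> \<psi> v" if "u \<in> Q2" "v \<in> Q2" for u v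
    using h.hom_mult that by simp
  have h_inv: "\<psi> (inv u) = inv (\<psi> u)" if "u \<in> Q2" for u
    using h.hom_inv[of u] h.hom_closed[of u] that
      m_inv_consistent[OF sub(3)] m_inv_consistent[OF sub(4)] by simp
  have h_one: "\<psi> \<one> = \<one>" using h.hom_one by simp
  have xyQ2: "{x, y} \<subseteq> Q2" using QQ1 QQ2 by auto
  have gQ2: "generate P {x, y} \<subseteq> Q2" by (rule generate_subgroup_incl[OF xyQ2 sub(3)])
  have \<psi>z: "\<psi> z = z"
    using z
  proof (induction rule: generate.induct)
    case (eng u v) then show ?case using gQ2 by (simp add: h_mult subset_iff)
  qed (use xyQ2 \<psi>x \<psi>(3) in \<open>auto simp: h_one h_inv\<close>)
  have zQ: "insert z Q \<subseteq> Q2" using z gQ2 QQ1 QQ2 by auto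
  have Q3Q2: "Q3 \<subseteq> Q2" unfolding Q3_def by (rule generate_subgroup_incl[OF zQ sub(3)])
  have \<phi>R: "\<phi> v \<in> R" if "v \<in> Q" for v
    using morphism[OF Q R \<phi>] that by (auto simp: hom_def)
  have R3: "insert z R \<subseteq> R3" unfolding R3_def by (auto intro: generate.incl)
  have im: "\<psi> w \<in> R3" if "w \<in> Q3" for w
    using that unfolding Q3_def
  proof (induction rule: generate.induct)
    case one show ?case using subgroup.one_closed[OF sub(6)] by (simp add: h_one)
  next
    case (incl u) then show ?case using R3 \<psi>z ext \<phi>R by auto
  next
    case (inv u)
    then have "\<psi> u \<in> R3" using R3 \<psi>z ext \<phi>R by auto
    moreover have "u \<in> Q2" using inv zQ by auto
    ultimately show ?case using subgroup.m_inv_closed[OF sub(6)] by (simp add: h_inv)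
  next
    case (eng u v)
    then show ?case using Q3Q2 subgroup.m_closed[OF sub(6)] by (simp add: Q3_def h_mult subset_iff)
  qed
  define \<chi> where "\<chi> = compose Q3 \<psi> (\<lambda>v\<in>Q3. v)"
  have \<chi>: "\<chi> \<in> F Q3 R2" unfolding \<chi>_def
    using comp_morphism[OF sub(5,3,4) inclusion_morphism[OF sub(5,3) Q3Q2] \<psi>(1)] .
  have \<chi>_eq: "\<chi> v = \<psi> v" if "v \<in> Q3" for v using that by (simp add: \<chi>_def compose_def)
  interpret k: group_hom "P\<lparr>carrier := Q3\<rparr>" "P\<lparr>carrier := R2\<rparr>" \<chi>
    using morphism[OF sub(5,4) \<chi>] subgroup_imp_group[OF sub(5)] subgroup_imp_group[OF sub(4)]
    by (simp add: group_hom_def group_hom_axioms_def)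
  have "subgroup (\<chi> ` Q3) (P\<lparr>carrier := R2\<rparr>)" using k.img_is_subgroup by simp
  then have subim: "subgroup (\<chi> ` Q3) P" using incl_subgroup sub(4) by blast
  have "\<chi> ` Q3 \<subseteq> R3" using im by (auto simp: \<chi>_eq)
  then have "compose Q3 (\<lambda>v\<in>\<chi> ` Q3. v) \<chi> \<in> F Q3 R3"
    using comp_morphism[OF sub(5) subim sub(6) image_morphism[OF sub(5,4) \<chi>]
        inclusion_morphism[OF subim sub(6)]] by blast
  moreover have "compose Q3 (\<lambda>v\<in>\<chi> ` Q3. v) \<chi> v = \<psi> v" if "v \<in> Q3" for v
    using that by (simp add: compose_def \<chi>_eq)
  moreover have "insert z Q \<subseteq> Q3" unfolding Q3_def by (auto intro: generate.incl)
  ultimately show "\<exists>\<psi> \<in> F (generate P (insert z Q)) (generate P (insert z R)).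
      (\<forall>y\<in>Q. \<psi> y = \<phi> y) \<and> \<psi> z = z"
    unfolding Q3_def[symmetric] R3_def[symmetric] using \<psi>z ext
    by (intro bexI[of _ "compose Q3 (\<lambda>v\<in>\<chi> ` Q3. v) \<chi>"]) auto
qed

lemma one_in_fusion_centre: "\<one> \<in> fusion_centre P F"
  unfolding fusion_centre_def
proof (intro CollectI conjI allI impI)
  fix Q R \<phi> assume *: "subgroup Q P \<and> subgroup R P \<and> \<phi> \<in> F Q R"
  have g: "generate P (insert \<one> S) = S" if "subgroup S P" for S
    using generate_subgroup_incl[of "insert \<one> S" S] that subgroup.one_closed[OF that]
    by (auto intro: generate.incl)
  interpret k: group_hom "P\<lparr>carrier := Q\<rparr>" "P\<lparr>carrier := R\<rparr>" \<phi>
    using * morphism[of Q R \<phi>] subgroup_imp_group[of Q] subgroup_imp_group[of R]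
    by (simp add: group_hom_def group_hom_axioms_def)
  show "\<exists>\<psi> \<in> F (generate P (insert \<one> Q)) (generate P (insert \<one> R)).
      (\<forall>y\<in>Q. \<psi> y = \<phi> y) \<and> \<psi> \<one> = \<one>"
    using * k.hom_one by (intro bexI[of _ \<phi>]) (simp_all add: g)
qed simp

theorem strongly_closed_fusion_centre: "strongly_closed P F (fusion_centre P F)"
  unfolding strongly_closed_def
proof (intro conjI allI impI)
  show "subgroup (fusion_centre P F) P"
  proof (rule subgroupI)
    show "fusion_centre P F \<subseteq> carrier P" using fusion_centre_carrier by blast
    show "fusion_centre P F \<noteq> {}" using one_in_fusion_centre by blast
    show "inv x \<in> fusion_centre P F" if "x \<in> fusion_centre P F" for x
      using that by (rule fusion_centre_generate[of x x]) (auto intro: that generate.inv)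
    show "x \<otimes> y \<in> fusion_centre P F" if "x \<in> fusion_centre P F" "y \<in> fusion_centre P F" for x y
      using that by (rule fusion_centre_generate) (auto intro: generate.eng generate.incl)
  qed
  fix Q \<phi> assume "subgroup Q P \<and> Q \<subseteq> fusion_centre P F \<and> \<phi> \<in> F Q (carrier P)"
  then show "\<phi> ` Q \<subseteq> fusion_centre P F"
    using fusion_centre_fixed[of _ Q "carrier P" \<phi>] subgroup_self by (auto simp: subset_iff)
qed

theorem fusion_centre_normal: "fusion_centre P F \<lhd> P"
proof (rule normal_invI)
  show Z: "subgroup (fusion_centre P F) P"
    using strongly_closed_fusion_centre by (simp add: strongly_closed_def)
  fix g z assume g: "g \<in> carrier P" and z: "z \<in> fusion_centre P F"
  have "restrict (conj_by P (inv g)) (carrier P) \<in> group_fusion P (carrier P) (carrier P)"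
    unfolding group_fusion_def using g by (auto simp: conj_by_def)
  then have "restrict (conj_by P (inv g)) (carrier P) \<in> F (carrier P) (carrier P)"
    using conj_morphism subgroup_self by blast
  then have "restrict (conj_by P (inv g)) (carrier P) z = z"
    using fusion_centre_fixed z subgroup_self fusion_centre_carrier by blast
  then show "g \<otimes> z \<otimes> inv g \<in> fusion_centre P F"
    using z g fusion_centre_carrier[OF z] by (simp add: conj_by_def)
qed

end

definition fusion_second_centre ::
  "('a, 'm) monoid_scheme \<Rightarrow> ('a set \<Rightarrow> 'a set \<Rightarrow> ('a \<Rightarrow> 'a) set) \<Rightarrow> 'a set" where
  "fusion_second_centre P F =
    {x \<in> carrier P.
       fusion_centre P F #>\<^bsub>P\<^esub> x
         \<in> fusion_centre (P Mod fusion_centre P F) (quotient_fusion P F (fusion_centre P F))}"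

end

theory Submission
  imports Defs
begin

text \<open>
  As in Gruen's lemma for groups, let \<open>x \<in> Z\<^sub>2(\<F>)\<close>. Then \<open>y \<mapsto> [y, x]\<close> is a morphism from \<open>\<F>\<close> to
  the fusion system of an abelian subgroup of \<open>Z(\<F>)\<close>; perfectness makes it trivial, so \<open>x\<close> is
  central in \<open>P\<close>. Morphisms of \<open>\<F>\<close> move \<open>x\<close> only by elements of \<open>Z(\<F>)\<close>, so the central subgroup
  \<open>Z(\<F>)\<langle>x\<rangle>\<close> is its own only conjugate. It is therefore fully automized, its
  \<open>\<F>\<close>-automorphisms have order prime to \<open>p\<close>, and this forces them to fix \<open>x\<close>. Hence every
  morphism defined at \<open>x\<close> fixes it. Finally, receptivity extends every morphism to \<open>x\<close>, without
  recourse to Alperin's fusion theorem.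
\<close>

section \<open>Conjugation, normalizers and the subgroup \<open>N_phi\<close> in a group\<close>

context group
begin

lemma conj_by_closed [simp]:
  "g \<in> carrier G \<Longrightarrow> x \<in> carrier G \<Longrightarrow> conj_by G g x \<in> carrier G"
  by (simp add: conj_by_def)

text \<open>As a map written on the right, conjugation is a right action; in the functional notation
  used here the two factors therefore appear in reversed order.\<close>

lemma conj_by_mult:
  assumes "g \<in> carrier G" "h \<in> carrier G" "x \<in> carrier G"
  shows "conj_by G (g \<otimes> h) x = conj_by G h (conj_by G g x)"
  using assms by (simp add: conj_by_def inv_mult_group m_assoc)

lemma conj_by_one: "x \<in> carrier G \<Longrightarrow> conj_by G \<one> x = x"
  by (simp add: conj_by_def)

lemma conj_by_inv_cancel:
  assumes "g \<in> carrier G" "x \<in> carrier G"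
  shows "conj_by G (inv g) (conj_by G g x) = x" "conj_by G g (conj_by G (inv g) x) = x"
  using assms by (simp_all add: conj_by_mult[symmetric] conj_by_one)

lemma conj_by_eq_iff_commute:
  assumes "g \<in> carrier G" "x \<in> carrier G"
  shows "conj_by G g x = x \<longleftrightarrow> g \<otimes> x = x \<otimes> g"
proof -
  have "conj_by G g x = x \<longleftrightarrow> inv g \<otimes> (x \<otimes> g) = x"
    using assms by (simp add: conj_by_def m_assoc)
  also have "\<dots> \<longleftrightarrow> x \<otimes> g = g \<otimes> x"
    using assms inv_solve_left[of x g "x \<otimes> g"] by auto
  finally show ?thesis by auto
qed

lemma normalizer_conj_closed:
  assumes "subgroup H G" "g \<in> normalizer G H" "y \<in> H"
  shows "conj_by G g y \<in> H"
proof -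
  have N: "subgroup (normalizer G H) G"
    by (rule normalizer_imp_subgroup[OF subgroup.subset[OF assms(1)]])
  show ?thesis
    using normal.inv_op_closed1[OF subgroup_in_normalizer[OF assms(1)], of g y] assms(2,3)
      m_inv_consistent[OF N assms(2)]
    by (simp add: conj_by_def)
qed

lemma central_in_normalizer:
  assumes "H \<subseteq> carrier G" "c \<in> carrier G" "\<And>y. y \<in> H \<Longrightarrow> c \<otimes> y = y \<otimes> c"
  shows "c \<in> normalizer G H"
proof -
  \<comment> \<open>\<open>normalizer\<close> is the stabilizer of \<open>H\<close> under
    \<open>c <# H #> inv c\<close>, which conjugates in the direction opposite to
    \<open>conj_by\<close>.\<close>
  have "c \<otimes> y \<otimes> inv c = y" if "y \<in> H" for y
    using that assms inv_solve_right'[of y "c \<otimes> y" c] by (auto simp: subset_iff)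
  then have "c <# H #> inv c = H"
    unfolding l_coset_def r_coset_def by auto
  then show ?thesis using assms by (simp add: normalizer_def stabilizer_def)
qed

lemma subgroup_subset_normalizer:
  "subgroup H G \<Longrightarrow> H \<subseteq> normalizer G H"
  using normal_imp_subgroup[OF subgroup_in_normalizer] subgroup.subset by fastforce

text \<open>The witnesses \<open>h\<close> multiply and invert along with the elements
  \<open>g\<close>. Receptivity supplies morphisms with domain \<open>N_phi\<close>, and the axioms
  of a fusion system apply to them only once this domain is known to be a subgroup.\<close>

lemma subgroup_N_phi:
  assumes R: "subgroup R G" and Q: "subgroup Q G" and \<phi>: "\<And>y. y \<in> R \<Longrightarrow> \<phi> y \<in> carrier G"
  shows "subgroup (N_phi G R Q \<phi>) G"
proof -
  have NR: "subgroup (normalizer G R) G" and NQ: "subgroup (normalizer G Q) G"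
    using R Q by (simp_all add: normalizer_imp_subgroup subgroup.subset)
  note Rc = subgroup.mem_carrier[OF R] and NRc = subgroup.mem_carrier[OF NR]
    and NQc = subgroup.mem_carrier[OF NQ]
  show ?thesis
  proof (rule subgroupI)
    show "N_phi G R Q \<phi> \<subseteq> carrier G" unfolding N_phi_def using NRc by blast
    have "\<one> \<in> N_phi G R Q \<phi>"
      unfolding N_phi_def using subgroup.one_closed[OF NR] subgroup.one_closed[OF NQ] Rc \<phi>
      by (auto simp: conj_by_one intro!: bexI[of _ \<one>])
    then show "N_phi G R Q \<phi> \<noteq> {}" by blast
  next
    fix g assume "g \<in> N_phi G R Q \<phi>"
    then obtain h where g: "g \<in> normalizer G R" and h: "h \<in> normalizer G Q"
      and gh: "\<And>y. y \<in> R \<Longrightarrow> \<phi> (conj_by G g y) = conj_by G h (\<phi> y)"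
      unfolding N_phi_def by blast
    have "\<phi> (conj_by G (inv g) y) = conj_by G (inv h) (\<phi> y)" if y: "y \<in> R" for y
    proof -
      define w where "w = conj_by G (inv g) y"
      have w: "w \<in> R" unfolding w_def
        by (rule normalizer_conj_closed[OF R subgroup.m_inv_closed[OF NR g] y])
      have "conj_by G g w = y" unfolding w_def by (simp add: conj_by_inv_cancel Rc y NRc g)
      then have "\<phi> y = conj_by G h (\<phi> w)" using gh[OF w] by simp
      then show ?thesis by (simp add: w_def[symmetric] conj_by_inv_cancel NQc h \<phi> w)
    qed
    then show "inv g \<in> N_phi G R Q \<phi>"
      unfolding N_phi_def using subgroup.m_inv_closed[OF NR g] subgroup.m_inv_closed[OF NQ h] by blast
  next
    fix g1 g2 assume "g1 \<in> N_phi G R Q \<phi>" "g2 \<in> N_phi G R Q \<phi>"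
    then obtain h1 h2 where g: "g1 \<in> normalizer G R" "g2 \<in> normalizer G R"
      and h: "h1 \<in> normalizer G Q" "h2 \<in> normalizer G Q"
      and gh: "\<And>y. y \<in> R \<Longrightarrow> \<phi> (conj_by G g1 y) = conj_by G h1 (\<phi> y)"
        "\<And>y. y \<in> R \<Longrightarrow> \<phi> (conj_by G g2 y) = conj_by G h2 (\<phi> y)"
      unfolding N_phi_def by blast
    have "\<phi> (conj_by G (g1 \<otimes> g2) y) = conj_by G (h1 \<otimes> h2) (\<phi> y)" if y: "y \<in> R" for y
      using y by (simp add: conj_by_mult NRc NQc g h Rc \<phi> gh normalizer_conj_closed[OF R])
    then show "g1 \<otimes> g2 \<in> N_phi G R Q \<phi>"
      unfolding N_phi_def
      using subgroup.m_closed[OF NR g] subgroup.m_closed[OF NQ h] by blast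
  qed
qed

text \<open>Conjugation by a central element is trivial on both sides of the defining equation, so
  \<open>c\<close> is its own witness.\<close>

lemma central_in_N_phi:
  assumes "subgroup R G" "subgroup Q G" "\<And>y. y \<in> R \<Longrightarrow> \<phi> y \<in> carrier G"
    and c: "c \<in> carrier G" "\<And>y. y \<in> carrier G \<Longrightarrow> c \<otimes> y = y \<otimes> c"
  shows "c \<in> N_phi G R Q \<phi>"
proof -
  have "c \<in> normalizer G H" if "subgroup H G" for H
    using that c subgroup.subset by (intro central_in_normalizer) auto
  moreover have "conj_by G c y = y" if "y \<in> carrier G" for y
    using that c by (simp add: conj_by_eq_iff_commute)
  ultimately show ?thesis
    unfolding N_phi_def using assms subgroup.mem_carrier[OF assms(1)]
    by (auto intro!: bexI[of _ c])
qed

end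

section \<open>Elementary properties of morphisms in a fusion system\<close>

context fusion_system
begin

lemma morphism_group_hom:
  assumes "subgroup Q P" "subgroup R P" "\<phi> \<in> F Q R"
  shows "group_hom (P\<lparr>carrier := Q\<rparr>) (P\<lparr>carrier := R\<rparr>) \<phi>"
  using assms morphism[OF assms] subgroup_imp_group
  by (simp add: group_hom_def group_hom_axioms_def)

lemma morphism_closed:
  assumes "subgroup Q P" "subgroup R P" "\<phi> \<in> F Q R" "y \<in> Q"
  shows "\<phi> y \<in> R"
  using group_hom.hom_closed[OF morphism_group_hom[OF assms(1-3)]] assms(4) by simp

lemma morphism_carrier:
  assumes "subgroup Q P" "subgroup R P" "\<phi> \<in> F Q R" "y \<in> Q"
  shows "\<phi> y \<in> carrier P"
  using morphism_closed[OF assms] subgroup.mem_carrier[OF assms(2)] by blast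

lemma morphism_mult:
  assumes "subgroup Q P" "subgroup R P" "\<phi> \<in> F Q R" "y \<in> Q" "z \<in> Q"
  shows "\<phi> (y \<otimes> z) = \<phi> y \<otimes> \<phi> z"
  using group_hom.hom_mult[OF morphism_group_hom[OF assms(1-3)]] assms(4,5) by simp

lemma morphism_one:
  assumes "subgroup Q P" "subgroup R P" "\<phi> \<in> F Q R"
  shows "\<phi> \<one> = \<one>"
  using group_hom.hom_one[OF morphism_group_hom[OF assms]] by simp

lemma morphism_inv:
  assumes "subgroup Q P" "subgroup R P" "\<phi> \<in> F Q R" "y \<in> Q"
  shows "\<phi> (inv y) = inv (\<phi> y)"
  using group_hom.hom_inv[OF morphism_group_hom[OF assms(1-3)], of y] morphism_closed[OF assms]
    m_inv_consistent[OF assms(1)] m_inv_consistent[OF assms(2)] assms(4) by simp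

lemma morphism_conj_by:
  assumes "subgroup Q P" "subgroup R P" "\<phi> \<in> F Q R" "y \<in> Q" "z \<in> Q"
  shows "\<phi> (conj_by P y z) = conj_by P (\<phi> y) (\<phi> z)"
  using assms by (simp add: conj_by_def morphism_mult morphism_inv subgroup.m_closed
      subgroup.m_inv_closed)

lemma morphism_inj_on:
  assumes "subgroup Q P" "subgroup R P" "\<phi> \<in> F Q R"
  shows "inj_on \<phi> Q"
  using morphism[OF assms] by simp

lemma morphism_image_subgroup:
  assumes "subgroup Q P" "subgroup R P" "\<phi> \<in> F Q R"
  shows "subgroup (\<phi> ` Q) P"
  using group_hom.img_is_subgroup[OF morphism_group_hom[OF assms]] incl_subgroup[OF assms(2)]
  by simp

lemma restrict_morphism:
  assumes "subgroup Q P" "subgroup R P" "\<phi> \<in> F Q R" "subgroup S P" "S \<subseteq> Q"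
  shows "restrict \<phi> S \<in> F S R"
proof -
  have "compose S \<phi> (\<lambda>x\<in>S. x) = restrict \<phi> S" by (auto simp: compose_def restrict_def)
  then show ?thesis
    using comp_morphism[OF assms(4,1,2) inclusion_morphism[OF assms(4,1,5)] assms(3)] by simp
qed

text \<open>The codomain can be changed by first shrinking it to the image and then composing with
  the inclusion of the image into \<open>S\<close>.\<close>

lemma morphism_into:
  assumes "subgroup Q P" "subgroup R P" "\<phi> \<in> F Q R" "subgroup S P" "\<phi> ` Q \<subseteq> S"
  shows "\<phi> \<in> F Q S"
proof -
  note im = morphism_image_subgroup[OF assms(1-3)]
  have "compose Q (\<lambda>x\<in>\<phi> ` Q. x) \<phi> = \<phi>"
    using morphism[OF assms(1-3)]
    by (intro extensionalityI[of _ Q]) (auto simp: compose_def)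
  then show ?thesis
    using comp_morphism[OF assms(1) im assms(4) image_morphism[OF assms(1-3)]
        inclusion_morphism[OF im assms(4,5)]] by simp
qed

lemma morphism_generate_image:
  assumes "K \<subseteq> carrier P" "subgroup R P" "\<phi> \<in> F (generate P K) R"
  shows "\<phi> ` generate P K = generate P (\<phi> ` K)"
proof -
  have g: "subgroup (generate P K) P" by (rule generate_is_subgroup[OF assms(1)])
  have K: "K \<subseteq> generate P K" by (auto intro: generate.incl)
  have "\<phi> ` K \<subseteq> R" using morphism_closed[OF g assms(2,3)] K by blast
  \<comment> \<open>Generation is transferred between \<open>P\<close> and its subgroups by
    \<open>generate_consistent\<close>, because \<open>\<phi>\<close> is a homomorphism only between
    the subgroups.\<close>
  then show ?thesis
    using group_hom.generate_img[OF morphism_group_hom[OF g assms(2,3)], of K] K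
      generate_consistent[OF K g] generate_consistent[OF _ assms(2), of "\<phi> ` K"]
    by simp
qed

lemma conj_by_morphism:
  assumes "g \<in> carrier P"
  shows "restrict (conj_by P g) (carrier P) \<in> F (carrier P) (carrier P)"
proof -
  have "restrict (conj_by P g) (carrier P) \<in> group_fusion P (carrier P) (carrier P)"
    unfolding group_fusion_def using assms by auto
  then show ?thesis using conj_morphism subgroup_self by blast
qed

text \<open>For \<open>g \<in> Q\<close> the witness is \<open>\<phi> g\<close>, since
  \<open>\<phi>\<close> is a homomorphism. Hence a morphism defined on \<open>N_phi\<close> and
  agreeing with \<open>\<phi>\<close> on \<open>Q\<close> really is an extension.\<close>

lemma subset_N_phi:
  assumes "subgroup Q P" "subgroup R P" "\<phi> \<in> F Q R"
  shows "Q \<subseteq> N_phi P Q R \<phi>"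
proof
  fix g assume g: "g \<in> Q"
  have "\<phi> g \<in> normalizer P R"
    using morphism_closed[OF assms g] subgroup_subset_normalizer[OF assms(2)] by blast
  then show "g \<in> N_phi P Q R \<phi>"
    unfolding N_phi_def
    using g subgroup_subset_normalizer[OF assms(1)] morphism_conj_by[OF assms g] by blast
qed

text \<open>Conjugation by \<open>y\<close> is a morphism defined on all of \<open>P\<close>, so it
  fixes the elements of Z(\<F>).\<close>

lemma fusion_centre_commute:
  assumes "z \<in> fusion_centre P F" "y \<in> carrier P"
  shows "z \<otimes> y = y \<otimes> z"
proof -
  have "conj_by P y z = z"
    using fusion_centre_fixed[OF assms(1) subgroup_self subgroup_self conj_by_morphism[OF assms(2)]]
      fusion_centre_carrier[OF assms(1)] by simp
  then show ?thesis using assms fusion_centre_carrier by (simp add: conj_by_eq_iff_commute)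
qed

end

section \<open>Extending morphisms to central elements by receptivity\<close>

context saturated_fusion_system
begin

text \<open>
  Both \<open>Q\<close> and \<open>\<phi> ` Q\<close> map isomorphically onto a common receptive subgroup, and these two maps
  extend to \<open>C\<close>, which lies in every \<^const>\<open>N_phi\<close>. As the extensions fix \<open>C\<close>, one followed by
  the inverse of the other extends \<open>\<phi>\<close>.
\<close>
lemma extend_central:
  assumes C: "C \<subseteq> carrier P" "\<And>c y. c \<in> C \<Longrightarrow> y \<in> carrier P \<Longrightarrow> c \<otimes> y = y \<otimes> c"
    and fixed: "\<And>Q R \<phi> c. subgroup Q P \<Longrightarrow> subgroup R P \<Longrightarrow> \<phi> \<in> F Q R \<Longrightarrow> c \<in> Q \<Longrightarrow> c \<in> C
      \<Longrightarrow> \<phi> c = c"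
    and Q: "subgroup Q P" and R: "subgroup R P" and \<phi>: "\<phi> \<in> F Q R"
  obtains \<psi> where "\<psi> \<in> F (generate P (C \<union> Q)) (generate P (C \<union> R))"
    "\<And>y. y \<in> Q \<Longrightarrow> \<psi> y = \<phi> y" "\<And>c. c \<in> C \<Longrightarrow> \<psi> c = c"
proof -
  define Q' where "Q' = \<phi> ` Q"
  have Q': "subgroup Q' P" unfolding Q'_def by (rule morphism_image_subgroup[OF Q R \<phi>])
  have \<phi>': "\<phi> \<in> F Q Q'" unfolding Q'_def by (rule image_morphism[OF Q R \<phi>])
  obtain S \<beta> where S: "subgroup S P" and \<beta>: "\<beta> \<in> F Q' S" "\<beta> ` Q' = S" and rec: "receptive P F S"
    using saturated[OF Q'] by blast
  have ext: "\<exists>\<alpha>' \<in> F (generate P (C \<union> T)) (carrier P).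
      (\<forall>y\<in>T. \<alpha>' y = \<alpha> y) \<and> (\<forall>c\<in>C. \<alpha>' c = c) \<and>
      \<alpha>' ` generate P (C \<union> T) = generate P (C \<union> S)"
    if T: "subgroup T P" and \<alpha>: "\<alpha> \<in> F T S" "\<alpha> ` T = S" for T \<alpha>
  proof -
    let ?N = "N_phi P T S \<alpha>" and ?D = "generate P (C \<union> T)"
    note \<alpha>c = morphism_carrier[OF T S \<alpha>(1)]
    have N: "subgroup ?N P" by (rule subgroup_N_phi[OF T S \<alpha>c])
    have "C \<subseteq> ?N"
    proof
      fix c assume c: "c \<in> C"
      show "c \<in> ?N"
        by (rule central_in_N_phi[OF T S \<alpha>c]) (use C(1) C(2)[OF c] c in auto)
    qed
    then have CT: "C \<union> T \<subseteq> ?N" using subset_N_phi[OF T S \<alpha>(1)] by blast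
    have CTP: "C \<union> T \<subseteq> carrier P" using C(1) subgroup.subset[OF T] by blast
    have D: "subgroup ?D P" by (rule generate_is_subgroup[OF CTP])
    have DN: "?D \<subseteq> ?N" by (rule generate_subgroup_incl[OF CT N])
    have CTD: "C \<union> T \<subseteq> ?D" by (auto intro: generate.incl)
    obtain \<gamma> where \<gamma>: "\<gamma> \<in> F ?N (carrier P)" "\<And>y. y \<in> T \<Longrightarrow> \<gamma> y = \<alpha> y"
      using rec T \<alpha> unfolding receptive_def by blast
    \<comment> \<open>\<open>N_phi\<close> may be larger than needed, and depends on
      \<open>T\<close>. After restriction to \<open>?D\<close> the image depends only on
      \<open>C\<close> and \<open>S\<close>, so the extensions for \<open>Q\<close> and for
      \<open>Q'\<close> have the same image and one can be composed with the inverse of the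
      other.\<close>
    have r: "restrict \<gamma> ?D \<in> F ?D (carrier P)"
      by (rule restrict_morphism[OF N subgroup_self \<gamma>(1) D DN])
    have rT: "restrict \<gamma> ?D y = \<alpha> y" if "y \<in> T" for y using that CTD \<gamma>(2) by auto
    have rC: "restrict \<gamma> ?D c = c" if "c \<in> C" for c
      using fixed[OF D subgroup_self r _ that] CTD that by blast
    have "restrict \<gamma> ?D ` (C \<union> T) = C \<union> S"
      using rT rC \<alpha>(2) by (simp only: image_Un) (auto cong: image_cong)
    then have "restrict \<gamma> ?D ` ?D = generate P (C \<union> S)"
      using morphism_generate_image[OF CTP subgroup_self r] by simp
    with r rT rC show ?thesis by blast
  qed
  let ?D = "generate P (C \<union> Q)" and ?D' = "generate P (C \<union> Q')" and ?E = "generate P (C \<union> S)"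
  have sub: "subgroup (generate P (C \<union> T)) P" if "subgroup T P" for T
    using that C(1) subgroup.subset by (intro generate_is_subgroup) blast
  have inD: "C \<union> T \<subseteq> generate P (C \<union> T)" for T by (auto intro: generate.incl)
  define \<alpha> where "\<alpha> = compose Q \<beta> \<phi>"
  have \<alpha>: "\<alpha> \<in> F Q S" unfolding \<alpha>_def by (rule comp_morphism[OF Q Q' S \<phi>' \<beta>(1)])
  have \<alpha>y: "\<alpha> y = \<beta> (\<phi> y)" if "y \<in> Q" for y using that by (simp add: \<alpha>_def compose_def)
  have "\<alpha> ` Q = S" using \<beta>(2) by (auto simp: Q'_def \<alpha>y image_iff)
  then obtain \<alpha>' where \<alpha>': "\<alpha>' \<in> F ?D (carrier P)" "\<And>y. y \<in> Q \<Longrightarrow> \<alpha>' y = \<alpha> y"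
    "\<And>c. c \<in> C \<Longrightarrow> \<alpha>' c = c" "\<alpha>' ` ?D = ?E"
    using ext[OF Q \<alpha>] by blast
  obtain \<beta>' where \<beta>': "\<beta>' \<in> F ?D' (carrier P)" "\<And>y. y \<in> Q' \<Longrightarrow> \<beta>' y = \<beta> y"
    "\<And>c. c \<in> C \<Longrightarrow> \<beta>' c = c" "\<beta>' ` ?D' = ?E"
    using ext[OF Q' \<beta>] by blast
  have inv: "restrict (inv_into ?D' \<beta>') ?E \<in> F ?E ?D'"
    using inverse_morphism[OF sub[OF Q'] subgroup_self \<beta>'(1)] \<beta>'(4) by simp
  have \<alpha>'E: "\<alpha>' \<in> F ?D ?E"
    using image_morphism[OF sub[OF Q] subgroup_self \<alpha>'(1)] \<alpha>'(4) by simp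
  define \<psi> where "\<psi> = compose ?D (restrict (inv_into ?D' \<beta>') ?E) \<alpha>'"
  have \<psi>D': "\<psi> \<in> F ?D ?D'"
    unfolding \<psi>_def by (rule comp_morphism[OF sub[OF Q] sub[OF S] sub[OF Q'] \<alpha>'E inv])
  have "Q' \<subseteq> R" using morphism_closed[OF Q R \<phi>] by (auto simp: Q'_def)
  then have "?D' \<subseteq> generate P (C \<union> R)" by (intro mono_generate) blast
  then have \<psi>: "\<psi> \<in> F ?D (generate P (C \<union> R))"
    using morphism_into[OF sub[OF Q] sub[OF Q'] \<psi>D' sub[OF R]]
      morphism_closed[OF sub[OF Q] sub[OF Q'] \<psi>D'] by blast
  note inj = morphism_inj_on[OF sub[OF Q'] subgroup_self \<beta>'(1)]
  \<comment> \<open>As \<open>\<beta>'\<close> is injective, a value of \<open>\<psi>\<close> is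
    found by naming a preimage \<open>w\<close> under \<open>\<beta>'\<close>: this is
    \<open>\<phi> y\<close> for \<open>y \<in> Q\<close>, and \<open>c\<close> itself for
    \<open>c \<in> C\<close>.\<close>
  have key: "\<psi> y = w" if "y \<in> ?D" "w \<in> ?D'" "\<alpha>' y = \<beta>' w" for y w
  proof -
    have "\<beta>' w \<in> ?E" using that(2) \<beta>'(4) by blast
    then show ?thesis using that inv_into_f_f[OF inj that(2)] by (simp add: \<psi>_def compose_def)
  qed
  show thesis
  proof (rule that[OF \<psi>])
    fix y assume y: "y \<in> Q"
    then have "\<phi> y \<in> Q'" by (simp add: Q'_def)
    then show "\<psi> y = \<phi> y" using y inD by (intro key) (auto simp: \<alpha>' \<beta>' \<alpha>y)
  next
    fix c assume "c \<in> C"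
    then show "\<psi> c = c" using inD by (intro key) (auto simp: \<alpha>' \<beta>')
  qed
qed

text \<open>The definition of Z(\<F>) adjoins one element at a time; \<open>extend_central\<close>
  adjoins all of them together. This is the step before passing to \<F>/Z(\<F>), whose morphisms
  come from subgroups containing Z(\<F>).\<close>

lemma fusion_centre_extend_all:
  assumes "subgroup Q P" "subgroup R P" "\<phi> \<in> F Q R"
  obtains \<psi> where
    "\<psi> \<in> F (generate P (fusion_centre P F \<union> Q)) (generate P (fusion_centre P F \<union> R))"
    "\<And>y. y \<in> Q \<Longrightarrow> \<psi> y = \<phi> y"
proof (rule extend_central[of "fusion_centre P F", OF _ _ _ assms])
  show "fusion_centre P F \<subseteq> carrier P" using fusion_centre_carrier by blast
qed (use fusion_centre_commute fusion_centre_fixed that in blast)+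

text \<open>The extension demanded by the definition of the centre comes from
  \<open>extend_central\<close> with \<open>C = {x}\<close>, so it is enough to look at morphisms
  already defined at \<open>x\<close>.\<close>

lemma fusion_centreI:
  assumes x: "x \<in> carrier P" "\<And>y. y \<in> carrier P \<Longrightarrow> x \<otimes> y = y \<otimes> x"
    and fixed: "\<And>Q R \<phi>. subgroup Q P \<Longrightarrow> subgroup R P \<Longrightarrow> \<phi> \<in> F Q R \<Longrightarrow> x \<in> Q \<Longrightarrow> \<phi> x = x"
  shows "x \<in> fusion_centre P F"
  unfolding fusion_centre_def
proof (intro CollectI conjI allI impI)
  show "x \<in> carrier P" by (fact x)
  fix Q R \<phi> assume "subgroup Q P \<and> subgroup R P \<and> \<phi> \<in> F Q R"
  then have *: "subgroup Q P" "subgroup R P" "\<phi> \<in> F Q R" by auto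
  obtain \<psi> where "\<psi> \<in> F (generate P ({x} \<union> Q)) (generate P ({x} \<union> R))"
    "\<And>y. y \<in> Q \<Longrightarrow> \<psi> y = \<phi> y" "\<And>c. c \<in> {x} \<Longrightarrow> \<psi> c = c"
    by (rule extend_central[of "{x}", OF _ _ _ *]) (use x fixed in auto)
  then show "\<exists>\<psi>\<in>F (generate P (insert x Q)) (generate P (insert x R)).
      (\<forall>y\<in>Q. \<psi> y = \<phi> y) \<and> \<psi> x = x" by auto
qed

end


section \<open>Cosets and the morphisms of \<F>/Z(\<F>)\<close>

lemma (in group) rcos_eq_iff:
  assumes "subgroup T G" "x \<in> carrier G" "y \<in> carrier G"
  shows "T #> x = T #> y \<longleftrightarrow> (\<exists>t\<in>T. x = t \<otimes> y)"
proof
  assume "T #> x = T #> y"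
  then have "x \<in> T #> y" using rcos_self[OF assms(2,1)] by simp
  then show "\<exists>t\<in>T. x = t \<otimes> y" by (auto simp: r_coset_def)
next
  assume "\<exists>t\<in>T. x = t \<otimes> y"
  then have "x \<in> T #> y" by (auto simp: r_coset_def)
  then show "T #> x = T #> y" using repr_independence[OF _ assms(3,1)] by simp
qed

text \<open>Since \<open>T \<subseteq> Q\<close>, the subgroup \<open>Q\<close> is a union of cosets
  of \<open>T\<close>.\<close>

lemma (in group) rcos_image_mem_iff:
  assumes "subgroup T G" "subgroup Q G" "T \<subseteq> Q" "x \<in> carrier G"
  shows "T #> x \<in> (\<lambda>y. T #> y) ` Q \<longleftrightarrow> x \<in> Q"
proof
  assume "T #> x \<in> (\<lambda>y. T #> y) ` Q"
  then obtain y where y: "y \<in> Q" "T #> x = T #> y" by blast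
  then obtain t where "t \<in> T" "x = t \<otimes> y"
    using rcos_eq_iff[OF assms(1,4) subgroup.mem_carrier[OF assms(2) y(1)]] by blast
  then show "x \<in> Q" using assms(3) y(1) subgroup.m_closed[OF assms(2)] by blast
qed blast

context fusion_system
begin

lemma subgroup_fusion_centre: "subgroup (fusion_centre P F) P"
  using strongly_closed_fusion_centre by (simp add: strongly_closed_def)

lemma quotient_fusionE:
  assumes "\<psi> \<in> quotient_fusion P F T Q' R'"
  obtains Q R \<phi> where "subgroup Q P" "subgroup R P" "T \<subseteq> Q"
    "Q' = (\<lambda>x. T #> x) ` Q" "\<phi> \<in> F Q R" "\<forall>x\<in>Q. \<psi> (T #> x) = T #> \<phi> x"
  using assms unfolding quotient_fusion_def by (elim CollectE conjE exE) (rule that)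

text \<open>A morphism fixes Z(\<F>) elementwise, so
  \<open>\<phi> (z \<otimes> y) = z \<otimes> \<phi> y\<close> for \<open>z\<close> in Z(\<F>), and
  the induced map on cosets does not depend on the representative, which is picked by
  \<open>SOME\<close>.\<close>

lemma quotient_morphism_exists:
  assumes Q: "subgroup Q P" and R: "subgroup R P" and \<phi>: "\<phi> \<in> F Q R"
    and Z: "fusion_centre P F \<subseteq> Q" "fusion_centre P F \<subseteq> R"
  obtains \<psi> where
    "\<psi> \<in> quotient_fusion P F (fusion_centre P F)
      ((\<lambda>y. fusion_centre P F #> y) ` Q) ((\<lambda>y. fusion_centre P F #> y) ` R)"
    "\<And>y. y \<in> Q \<Longrightarrow> \<psi> (fusion_centre P F #> y) = fusion_centre P F #> \<phi> y"
proof -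
  let ?Z = "fusion_centre P F"
  note ZP = subgroup_fusion_centre
  note Qc = subgroup.mem_carrier[OF Q]
  define \<psi> where "\<psi> = (\<lambda>K\<in>(\<lambda>y. ?Z #> y) ` Q. ?Z #> \<phi> (SOME y. y \<in> Q \<and> ?Z #> y = K))"
  have \<psi>: "\<psi> (?Z #> y) = ?Z #> \<phi> y" if y: "y \<in> Q" for y
  proof -
    define w where "w = (SOME w. w \<in> Q \<and> ?Z #> w = ?Z #> y)"
    have "w \<in> Q \<and> ?Z #> w = ?Z #> y" unfolding w_def by (rule someI) (use y in simp)
    then have w: "w \<in> Q" "?Z #> w = ?Z #> y" by auto
    then obtain z where z: "z \<in> ?Z" "w = z \<otimes> y" using rcos_eq_iff[OF ZP Qc Qc] y by blast
    then have zQ: "z \<in> Q" using Z by blast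
    have "\<phi> w = z \<otimes> \<phi> y"
      using morphism_mult[OF Q R \<phi> zQ y] fusion_centre_fixed[OF z(1) Q R \<phi> zQ] z by simp
    then have "?Z #> \<phi> w = ?Z #> \<phi> y"
      using rcos_eq_iff[OF ZP] morphism_carrier[OF Q R \<phi>] w y z(1) by blast
    then show ?thesis using y by (simp add: \<psi>_def w_def)
  qed
  have "\<psi> \<in> quotient_fusion P F ?Z ((\<lambda>y. ?Z #> y) ` Q) ((\<lambda>y. ?Z #> y) ` R)"
    unfolding quotient_fusion_def
  proof (intro CollectI conjI exI)
    show "\<psi> \<in> extensional ((\<lambda>y. ?Z #> y) ` Q)" by (simp add: \<psi>_def)
  qed (use assms \<psi> in auto)
  with \<psi> that show thesis by blast
qed

text \<open>The coset of \<open>x\<close> is the identity of the quotient. Adjoining it to a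
  subgroup changes nothing, and a morphism of \<F>/Z(\<F>) fixes it because a lift to \<F> fixes
  \<open>\<one>\<close>; so each morphism is its own extension.\<close>

lemma fusion_centre_subset_second_centre:
  "fusion_centre P F \<subseteq> fusion_second_centre P F"
proof
  fix x assume x: "x \<in> fusion_centre P F"
  let ?Z = "fusion_centre P F"
  interpret N: normal ?Z P by (rule fusion_centre_normal)
  interpret M: group "P Mod ?Z" by (rule N.factorgroup_is_group)
  have xP: "x \<in> carrier P" by (rule fusion_centre_carrier[OF x])
  have Zx: "?Z #> x = ?Z" by (rule coset_join2[OF xP subgroup_fusion_centre x])
  have "?Z \<in> fusion_centre (P Mod ?Z) (quotient_fusion P F ?Z)"
    unfolding fusion_centre_def[of "P Mod ?Z"]
  proof (intro CollectI conjI allI impI)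
    show "?Z \<in> carrier (P Mod ?Z)" using M.one_closed by simp
    fix Q R \<phi>
    assume *: "subgroup Q (P Mod ?Z) \<and> subgroup R (P Mod ?Z) \<and> \<phi> \<in> quotient_fusion P F ?Z Q R"
    have gen: "generate (P Mod ?Z) (insert ?Z S) = S" if "subgroup S (P Mod ?Z)" for S
      using M.generate_subgroup_incl[of "insert ?Z S" S] that subgroup.one_closed[OF that]
      by (auto intro: generate.incl)
    obtain Q' R' \<phi>' where Q': "subgroup Q' P" "subgroup R' P" "\<phi>' \<in> F Q' R'"
      "\<forall>y\<in>Q'. \<phi> (?Z #> y) = ?Z #> \<phi>' y"
      using * by (elim conjE quotient_fusionE)
    have "\<phi> (?Z #> \<one>) = ?Z #> \<one>"
      using Q'(4) subgroup.one_closed[OF Q'(1)] morphism_one[OF Q'(1-3)] by metis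
    then have "\<phi> ?Z = ?Z" using subgroup.subset[OF subgroup_fusion_centre] by simp
    then show "\<exists>\<psi>\<in>quotient_fusion P F ?Z (generate (P Mod ?Z) (insert ?Z Q))
          (generate (P Mod ?Z) (insert ?Z R)). (\<forall>y\<in>Q. \<psi> y = \<phi> y) \<and> \<psi> ?Z = ?Z"
      using * by (auto simp: gen)
  qed
  then show "x \<in> fusion_second_centre P F"
    unfolding fusion_second_centre_def using xP by (simp add: Zx)
qed

end

section \<open>The action of \<F> on the second centre, and the commutator map\<close>

context saturated_fusion_system
begin

lemma second_centre_carrier: "x \<in> fusion_second_centre P F \<Longrightarrow> x \<in> carrier P"
  by (simp add: fusion_second_centre_def)

text \<open>The morphism is extended to Z(\<F>), pushed down to \<F>/Z(\<F>), extended there so as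
  to fix the coset of \<open>x\<close>, and lifted back. The lift \<open>\<psi>\<close> agrees with
  \<open>\<phi>\<close> on \<open>Q\<close> only modulo Z(\<F>), so later arguments must absorb
  central factors.\<close>

lemma second_centre_extend:
  assumes x: "x \<in> fusion_second_centre P F"
    and Q: "subgroup Q P" and R: "subgroup R P" and \<phi>: "\<phi> \<in> F Q R"
  obtains S T \<psi> where "subgroup S P" "subgroup T P" "\<psi> \<in> F S T"
    "Q \<subseteq> S" "fusion_centre P F \<subseteq> S" "x \<in> S"
    "\<And>y. y \<in> Q \<Longrightarrow> fusion_centre P F #> \<psi> y = fusion_centre P F #> \<phi> y"
    "fusion_centre P F #> \<psi> x = fusion_centre P F #> x"
proof -
  let ?Z = "fusion_centre P F"
  let ?c = "\<lambda>y. ?Z #> y"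
  let ?Q = "generate P (?Z \<union> Q)" and ?R = "generate P (?Z \<union> R)"
  have xP: "x \<in> carrier P" by (rule second_centre_carrier[OF x])
  interpret N: normal ?Z P by (rule fusion_centre_normal)
  interpret M: group "P Mod ?Z" by (rule N.factorgroup_is_group)
  interpret c: group_hom P "P Mod ?Z" ?c
    by unfold_locales (rule N.r_coset_hom_Mod)
  obtain \<phi>1 where \<phi>1: "\<phi>1 \<in> F ?Q ?R" "\<And>y. y \<in> Q \<Longrightarrow> \<phi>1 y = \<phi> y"
    using fusion_centre_extend_all[OF Q R \<phi>] by blast
  have sub: "subgroup (generate P (?Z \<union> S)) P" if "subgroup S P" for S
    using that subgroup.subset subgroup_fusion_centre by (intro generate_is_subgroup) blast
  have inZ: "?Z \<union> S \<subseteq> generate P (?Z \<union> S)" for S by (auto intro: generate.incl)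
  obtain \<phi>2 where \<phi>2: "\<phi>2 \<in> quotient_fusion P F ?Z (?c ` ?Q) (?c ` ?R)"
    "\<And>y. y \<in> ?Q \<Longrightarrow> \<phi>2 (?c y) = ?c (\<phi>1 y)"
    using quotient_morphism_exists[OF sub[OF Q] sub[OF R] \<phi>1(1)] inZ by blast
  let ?S = "generate (P Mod ?Z) (insert (?c x) (?c ` ?Q))"
  let ?T = "generate (P Mod ?Z) (insert (?c x) (?c ` ?R))"
  have "?c x \<in> fusion_centre (P Mod ?Z) (quotient_fusion P F ?Z)"
    using x by (simp add: fusion_second_centre_def)
  moreover have "subgroup (?c ` ?Q) (P Mod ?Z)" "subgroup (?c ` ?R) (P Mod ?Z)"
    using c.subgroup_img_is_subgroup sub Q R by blast+
  ultimately obtain \<psi>' where \<psi>': "\<psi>' \<in> quotient_fusion P F ?Z ?S ?T"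
    "\<And>K. K \<in> ?c ` ?Q \<Longrightarrow> \<psi>' K = \<phi>2 K" "\<psi>' (?c x) = ?c x"
    using \<phi>2(1) unfolding fusion_centre_def[of "P Mod ?Z"] by blast
  obtain S T \<psi> where S: "subgroup S P" "subgroup T P" "?Z \<subseteq> S" "?S = ?c ` S"
    and \<psi>: "\<psi> \<in> F S T" "\<forall>y\<in>S. \<psi>' (?c y) = ?c (\<psi> y)"
    using \<psi>'(1) by (elim quotient_fusionE)
  \<comment> \<open>\<open>S\<close> contains \<open>?Z\<close> and is therefore the full preimage
    of \<open>?S\<close>; this puts \<open>x\<close> and \<open>Q\<close> inside it.\<close>
  have S_mem: "y \<in> S" if "y \<in> carrier P" "?c y \<in> ?S" for y
    using rcos_image_mem_iff[OF subgroup_fusion_centre S(1,3) that(1)] that(2) S(4) by simp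
  have xS: "x \<in> S" by (rule S_mem[OF xP]) (auto intro: generate.incl)
  have QS: "y \<in> S" if "y \<in> Q" for y
    using that inZ subgroup.mem_carrier[OF Q] by (intro S_mem) (auto intro!: generate.incl)
  show thesis
  proof (rule that[OF S(1,2) \<psi>(1) _ S(3) xS])
    fix y assume y: "y \<in> Q"
    then have "y \<in> ?Q" using inZ by blast
    then have "\<psi>' (?c y) = ?c (\<phi>1 y)" using \<psi>'(2) \<phi>2(2) by simp
    then have "?c (\<psi> y) = ?c (\<phi>1 y)" using \<psi>(2) QS[OF y] by metis
    then show "?c (\<psi> y) = ?c (\<phi> y)" using \<phi>1(2) y by simp
  next
    show "?c (\<psi> x) = ?c x" using \<psi>(2) xS \<psi>'(3) by simp
  qed (use QS in blast)
qed

text \<open>At \<open>x\<close> the lift \<open>\<psi>\<close> of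
  \<open>second_centre_extend\<close> agrees modulo Z(\<F>) both with \<open>\<phi>\<close> and with
  the identity.\<close>

lemma second_centre_moved_by_centre:
  assumes x: "x \<in> fusion_second_centre P F" "x \<in> Q"
    and Q: "subgroup Q P" and R: "subgroup R P" and \<phi>: "\<phi> \<in> F Q R"
  obtains z where "z \<in> fusion_centre P F" "\<phi> x = z \<otimes> x"
proof -
  obtain S T \<psi> where "subgroup S P" "subgroup T P" "\<psi> \<in> F S T"
    and "fusion_centre P F #> \<psi> x = fusion_centre P F #> \<phi> x"
    "fusion_centre P F #> \<psi> x = fusion_centre P F #> x"
    using second_centre_extend[OF x(1) Q R \<phi>] x(2) by metis
  then have "fusion_centre P F #> \<phi> x = fusion_centre P F #> x" by simp
  then show thesis
    using that rcos_eq_iff[OF subgroup_fusion_centre] morphism_carrier[OF Q R \<phi> x(2)]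
      second_centre_carrier[OF x(1)] by blast
qed

lemma finite_p_group_subgroup:
  assumes "Factorial_Ring.prime p" "subgroup S P"
  shows "finite_p_group p (P\<lparr>carrier := S\<rparr>)"
proof -
  obtain n where fin: "finite (carrier P)" and n: "order P = p ^ n"
    using p_group by (auto simp: finite_p_group_def)
  have "card S dvd p ^ n"
    using lagrange[OF assms(2)] n by (metis dvd_triv_right)
  then obtain k where "card S = p ^ k"
    using divides_primepow_nat[OF assms(1)] by blast
  then show ?thesis
    using finite_subset[OF subgroup.subset[OF assms(2)] fin] subgroup_imp_group[OF assms(2)]
    by (auto simp: finite_p_group_def order_def)
qed

text \<open>Writing the conjugate of \<open>x\<close> by \<open>g\<close> as
  \<open>\<theta> g \<otimes> x\<close> gives a homomorphism \<open>\<theta>\<close> into Z(\<F>)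
  that is unchanged by morphisms of \<F>. It is then a surjective morphism onto the fusion system of
  its image, and perfectness makes this image trivial.\<close>

lemma second_centre_commute:
  assumes prime: "Factorial_Ring.prime p" and perfect: "perfect_fusion p P F"
    and x: "x \<in> fusion_second_centre P F" and y: "y \<in> carrier P"
  shows "x \<otimes> y = y \<otimes> x"
proof -
  let ?Z = "fusion_centre P F"
  note Zc = fusion_centre_carrier and Zcomm = fusion_centre_commute
  have xP: "x \<in> carrier P" by (rule second_centre_carrier[OF x])
  \<comment> \<open>This is the commutator of \<open>g\<close> and \<open>inv x\<close>, in the
    convention where the commutator of a and b is
    \<open>inv a \<otimes> inv b \<otimes> a \<otimes> b\<close>.\<close>
  define \<theta> where "\<theta> g = conj_by P g x \<otimes> inv x" for g
  have \<theta>x: "conj_by P g x = \<theta> g \<otimes> x" if "g \<in> carrier P" for g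
    using that xP by (simp add: \<theta>_def m_assoc)
  have \<theta>Z: "\<theta> g \<in> ?Z" if g: "g \<in> carrier P" for g
  proof -
    obtain z where z: "z \<in> ?Z" "restrict (conj_by P g) (carrier P) x = z \<otimes> x"
      using second_centre_moved_by_centre[OF x xP subgroup_self subgroup_self conj_by_morphism[OF g]]
      by blast
    then have "\<theta> g = z" using xP Zc by (simp add: \<theta>_def m_assoc)
    with z show ?thesis by simp
  qed
  have \<theta>c: "\<theta> g \<in> carrier P" if "g \<in> carrier P" for g using \<theta>Z[OF that] Zc by blast
  have conjZ: "conj_by P g (z \<otimes> x) = z \<otimes> conj_by P g x" if "g \<in> carrier P" "z \<in> ?Z" for g z
  proof -
    have "inv g \<otimes> (z \<otimes> x) \<otimes> g = (inv g \<otimes> z) \<otimes> x \<otimes> g" using that xP Zc by (simp add: m_assoc)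
    also have "inv g \<otimes> z = z \<otimes> inv g" using Zcomm[OF that(2)] that(1) by simp
    finally show ?thesis using that xP Zc by (simp add: conj_by_def m_assoc)
  qed
  have hom: "\<theta> \<in> hom P P"
  proof (rule homI)
    fix g h assume g: "g \<in> carrier P" and h: "h \<in> carrier P"
    have "\<theta> (g \<otimes> h) \<otimes> x = \<theta> g \<otimes> \<theta> h \<otimes> x"
      using g h xP \<theta>c \<theta>Z conjZ[OF h \<theta>Z[OF g]]
      by (simp add: \<theta>x[symmetric] conj_by_mult) (simp add: \<theta>x m_assoc)
    then show "\<theta> (g \<otimes> h) = \<theta> g \<otimes> \<theta> h" using g h xP \<theta>c by simp
  qed (rule \<theta>c)
  interpret \<theta>: group_hom P P \<theta> by unfold_locales (rule hom)
  have inv: "\<theta> (\<phi> g) = \<theta> g"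
    if Q: "subgroup Q P" and R: "subgroup R P" and \<phi>: "\<phi> \<in> F Q R" and g: "g \<in> Q" for Q R \<phi> g
  proof -
    obtain S T \<psi> where S: "subgroup S P" and T: "subgroup T P" and \<psi>: "\<psi> \<in> F S T"
      and QS: "Q \<subseteq> S" and ZS: "?Z \<subseteq> S" and xS: "x \<in> S"
      and eq: "\<And>y. y \<in> Q \<Longrightarrow> ?Z #> \<psi> y = ?Z #> \<phi> y" "?Z #> \<psi> x = ?Z #> x"
      using second_centre_extend[OF x Q R \<phi>] by blast
    have gS: "g \<in> S" and gP: "g \<in> carrier P" using g QS subgroup.mem_carrier[OF Q] by auto
    have \<phi>g: "\<phi> g \<in> carrier P" by (rule morphism_carrier[OF Q R \<phi> g])
    note \<psi>c = morphism_carrier[OF S T \<psi>]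
    obtain z where z: "z \<in> ?Z" "\<psi> g = z \<otimes> \<phi> g"
      using eq(1)[OF g] rcos_eq_iff[OF subgroup_fusion_centre \<psi>c[OF gS] \<phi>g] by blast
    obtain z' where z': "z' \<in> ?Z" "\<psi> x = z' \<otimes> x"
      using eq(2) rcos_eq_iff[OF subgroup_fusion_centre \<psi>c[OF xS] xP] by blast
    have zP: "z \<in> carrier P" "z' \<in> carrier P" using z z' Zc by auto
    \<comment> \<open>The value of \<open>\<psi>\<close> at the conjugate of \<open>x\<close> by
      \<open>g\<close> is computed twice. As a conjugate of \<open>\<psi> x\<close> by
      \<open>\<psi> g\<close> it is \<open>z' \<otimes> (\<theta> (\<phi> g) \<otimes> x)\<close>:
      \<open>z\<close> acts trivially and \<open>z'\<close> can be pulled out. From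
      \<open>\<theta> g \<otimes> x\<close>, where \<open>\<psi>\<close> fixes
      \<open>\<theta> g\<close>, it is \<open>\<theta> g \<otimes> (z' \<otimes> x)\<close>.\<close>
    have "\<psi> (conj_by P g x) = conj_by P (z \<otimes> \<phi> g) (z' \<otimes> x)"
      using morphism_conj_by[OF S T \<psi> gS xS] z z' by simp
    also have "\<dots> = z' \<otimes> conj_by P (z \<otimes> \<phi> g) x" using conjZ zP \<phi>g z' by simp
    also have "conj_by P z x = x"
      using Zcomm[OF z(1) xP] conj_by_eq_iff_commute[OF zP(1) xP] by simp
    then have "conj_by P (z \<otimes> \<phi> g) x = \<theta> (\<phi> g) \<otimes> x"
      using conj_by_mult[OF zP(1) \<phi>g xP] \<theta>x[OF \<phi>g] by simp
    finally have 1: "\<psi> (conj_by P g x) = z' \<otimes> (\<theta> (\<phi> g) \<otimes> x)" .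
    have \<theta>S: "\<theta> g \<in> S" using \<theta>Z[OF gP] ZS by blast
    have "\<psi> (conj_by P g x) = \<theta> g \<otimes> (z' \<otimes> x)"
      using morphism_mult[OF S T \<psi> \<theta>S xS] fusion_centre_fixed[OF \<theta>Z[OF gP] S T \<psi> \<theta>S] \<theta>x[OF gP] z'
      by simp
    also have "\<dots> = z' \<otimes> (\<theta> g \<otimes> x)"
      using Zcomm[OF \<theta>Z[OF gP] zP(2)] \<theta>c[OF gP] zP xP m_assoc[symmetric] by simp
    finally show ?thesis using 1 \<theta>c gP \<phi>g zP xP by simp
  qed
  define A where "A = P\<lparr>carrier := \<theta> ` carrier P\<rparr>"
  have sub: "subgroup (\<theta> ` carrier P) P" by (rule \<theta>.img_is_subgroup)
  have group_A: "group A" unfolding A_def by (rule subgroup_imp_group[OF sub])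
  have "comm_group A"
    by (rule group.group_comm_groupI[OF group_A]) (auto simp: A_def \<theta>Z \<theta>c Zcomm)
  moreover have "finite_p_group p A" unfolding A_def by (rule finite_p_group_subgroup[OF prime sub])
  moreover have "fusion_morphism P F A (group_fusion A) \<theta>"
    unfolding fusion_morphism_def
  proof (intro conjI allI impI)
    show "\<theta> \<in> hom P A" using hom by (auto simp: A_def hom_def)
    fix Q R \<phi> assume *: "subgroup Q P \<and> subgroup R P \<and> \<phi> \<in> F Q R"
    then have QP: "Q \<subseteq> carrier P" using subgroup.subset by blast
    \<comment> \<open>Conjugation in the abelian group \<open>A\<close> is trivial, so the required
      map can only be the inclusion of \<open>\<theta>\<close> Q\<open>into\<close>\<theta>
      \<open>R\<close>; it exists because \<open>\<theta> (\<phi> g) = \<theta> g\<close>.\<close>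
    have one: "conj_by A \<one>\<^bsub>A\<^esub> (\<theta> g) = \<theta> g" if "g \<in> Q" for g
      using group.conj_by_one[OF group_A, of "\<theta> g"] that QP by (auto simp: A_def)
    have "\<theta> g \<in> \<theta> ` R" if "g \<in> Q" for g
      using inv[of Q R \<phi> g] morphism_closed[of Q R \<phi> g] * that by (metis imageI)
    then have "restrict (conj_by A \<one>\<^bsub>A\<^esub>) (\<theta> ` Q) \<in> group_fusion A (\<theta> ` Q) (\<theta> ` R)"
      unfolding group_fusion_def using one monoid.one_closed[OF group.is_monoid[OF group_A]] by auto
    moreover have "\<forall>g\<in>Q. \<theta> (\<phi> g) = restrict (conj_by A \<one>\<^bsub>A\<^esub>) (\<theta> ` Q) (\<theta> g)"
      using * one inv[of Q R \<phi>] by auto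
    ultimately show "\<exists>\<psi>\<in>group_fusion A (\<theta> ` Q) (\<theta> ` R). \<forall>g\<in>Q. \<theta> (\<phi> g) = \<psi> (\<theta> g)" by blast
  qed
  moreover have "\<theta> ` carrier P = carrier A" by (simp add: A_def)
  ultimately have "carrier A = {\<one>\<^bsub>A\<^esub>}" using perfect_fusionD[OF perfect] by blast
  then have "\<theta> y = \<one>" using y by (auto simp: A_def)
  then have "conj_by P y x = x" using \<theta>x[OF y] xP by simp
  then show ?thesis using conj_by_eq_iff_commute[OF y xP] by simp
qed

section \<open>Automorphisms of Z(\<F>)\<langle>x\<rangle> and the equality of the two
  centres\<close>

text \<open>Injective endomorphisms of the finite set \<open>Q\<close> are bijective. As
  \<open>F Q Q\<close> is thus a group, an automorphism raised to the power
  \<open>card (F Q Q)\<close> is the identity.\<close>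

lemma subgroup_Aut_fusion:
  assumes Q: "subgroup Q P"
  shows "subgroup (F Q Q) (BijGroup Q)"
proof -
  have "finite Q"
    using p_group finite_subset[OF subgroup.subset[OF Q]] by (simp add: finite_p_group_def)
  then have im: "\<phi> ` Q = Q" if "\<phi> \<in> F Q Q" for \<phi>
    using that morphism_inj_on[OF Q Q that] morphism_closed[OF Q Q that]
    by (intro endo_inj_surj) auto
  have Bij: "\<phi> \<in> Bij Q" if "\<phi> \<in> F Q Q" for \<phi>
    using that im[OF that] morphism[OF Q Q that] by (simp add: Bij_def bij_betw_def)
  show ?thesis
  proof (rule group.subgroupI[OF group_BijGroup])
    show "F Q Q \<subseteq> carrier (BijGroup Q)" using Bij by (auto simp: BijGroup_def)
    show "F Q Q \<noteq> {}" using inclusion_morphism[OF Q Q] by blast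
    show "inv\<^bsub>BijGroup Q\<^esub> \<phi> \<in> F Q Q" if "\<phi> \<in> F Q Q" for \<phi>
      using inverse_morphism[OF Q Q that] im[OF that] by (simp add: inv_BijGroup Bij that)
    show "\<phi> \<otimes>\<^bsub>BijGroup Q\<^esub> \<psi> \<in> F Q Q" if "\<phi> \<in> F Q Q" "\<psi> \<in> F Q Q" for \<phi> \<psi>
      using comp_morphism[OF Q Q Q that(2,1)] that by (simp add: BijGroup_def Bij)
  qed
qed

text \<open>
  For \<open>W = Z(\<F>)\<langle>x\<rangle>\<close> the Sylow subgroup \<open>Aut\<^sub>P(W)\<close> of \<open>Aut\<^sub>\<F>(W)\<close> is trivial. If an
  automorphism \<open>\<gamma>\<close> of \<open>W\<close> maps \<open>x\<close> to \<open>zx\<close>, then \<open>\<gamma>\<^sup>n(x) = z\<^sup>nx\<close>, as \<open>\<gamma>\<close> fixes \<open>z\<close>; so the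
  order of \<open>z\<close> is both a power of \<open>p\<close> and prime to \<open>p\<close>.
\<close>
lemma second_centre_fixed:
  assumes prime: "Factorial_Ring.prime p" and perfect: "perfect_fusion p P F"
    and x: "x \<in> fusion_second_centre P F" "x \<in> Q"
    and Q: "subgroup Q P" and R: "subgroup R P" and \<phi>: "\<phi> \<in> F Q R"
  shows "\<phi> x = x"
proof -
  let ?Z = "fusion_centre P F"
  define W where "W = generate P (insert x ?Z)"
  have xP: "x \<in> carrier P" by (rule second_centre_carrier[OF x(1)])
  have WP: "insert x ?Z \<subseteq> carrier P" using xP fusion_centre_carrier by blast
  have W: "subgroup W P" unfolding W_def by (rule generate_is_subgroup[OF WP])
  have inW: "insert x ?Z \<subseteq> W" unfolding W_def by (auto intro: generate.incl)
  have finW: "finite W"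
    using p_group finite_subset[OF subgroup.subset[OF W]] by (simp add: finite_p_group_def)
  have WZ: "\<alpha> ` W = W" if S: "subgroup S P" and \<alpha>: "\<alpha> \<in> F W S" for S \<alpha>
  proof -
    obtain z where z: "z \<in> ?Z" "\<alpha> x = z \<otimes> x"
      using second_centre_moved_by_centre[OF x(1) _ W S \<alpha>] inW by blast
    have "\<alpha> x \<in> W" using z inW subgroup.m_closed[OF W] by auto
    moreover have "\<alpha> w = w" if "w \<in> ?Z" for w
      using fusion_centre_fixed[OF that W S \<alpha>] inW that by blast
    ultimately have "\<alpha> ` insert x ?Z \<subseteq> W" using inW by auto
    then have "generate P (\<alpha> ` insert x ?Z) \<subseteq> W" by (rule generate_subgroup_incl[OF _ W])
    then have "\<alpha> ` W \<subseteq> W"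
      using morphism_generate_image[OF WP S] \<alpha> by (simp add: W_def)
    then show ?thesis using endo_inj_surj[OF finW] morphism_inj_on[OF W S \<alpha>] by blast
  qed
  \<comment> \<open>\<open>W\<close> is generated by elements central in \<open>P\<close>: those of
    \<open>?Z\<close>, and \<open>x\<close> by \<open>second_centre_commute\<close>, where
    perfectness enters.\<close>
  have conj_W: "conj_by P g w = w" if "g \<in> carrier P" "w \<in> W" for g w
    using that(2) unfolding W_def
  proof (induction rule: generate.induct)
    case one
    then show ?case using that(1) by (simp add: conj_by_def)
  next
    case (incl w)
    then have "w \<in> carrier P" "w \<otimes> g = g \<otimes> w"
      using second_centre_commute[OF prime perfect x(1) that(1)] fusion_centre_commute that(1) WP
      by auto
    then show ?case using that(1) by (simp add: conj_by_eq_iff_commute)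
  next
    case (inv w)
    then have w: "w \<in> carrier P" "w \<otimes> g = g \<otimes> w"
      using second_centre_commute[OF prime perfect x(1) that(1)] fusion_centre_commute that(1) WP
      by auto
    then have "conj_by P w g = g" using that(1) by (simp add: conj_by_eq_iff_commute)
    then have "conj_by P (inv w) g = g" using w that(1) conj_by_inv_cancel(1)[of w g] by simp
    then show ?case using w that(1) by (simp add: conj_by_eq_iff_commute)
  next
    case (eng v w)
    then have vw: "v \<in> carrier P" "w \<in> carrier P" using generate_in_carrier[OF WP] by auto
    then have "g \<otimes> v = v \<otimes> g" "g \<otimes> w = w \<otimes> g"
      using eng that(1) by (simp_all add: conj_by_eq_iff_commute)
    then have "g \<otimes> (v \<otimes> w) = v \<otimes> w \<otimes> g"
      using vw that(1) by (metis m_assoc)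
    then show ?case using vw that(1) by (simp add: conj_by_eq_iff_commute)
  qed
  \<comment> \<open>Saturation provides a fully automized conjugate of \<open>W\<close>, and by
    \<open>WZ\<close> this is \<open>W\<close> itself.\<close>
  obtain R' \<alpha> where "subgroup R' P" "\<alpha> \<in> F W R'" "\<alpha> ` W = R'" "fully_automized p P F R'"
    using saturated[OF W] by blast
  then have "fully_automized p P F W" using WZ by metis
  then have fin: "finite (F W W)"
    and card: "card (group_fusion P W W) = p ^ multiplicity p (card (F W W))"
    by (simp_all add: fully_automized_def sylow_subgroup_def Aut_fusion_def order_def)
  have rW: "restrict (conj_by P g) W = (\<lambda>w\<in>W. w)" if "g \<in> carrier P" for g
    using conj_W[OF that] by (intro restrict_ext) simp
  have "group_fusion P W W = {\<lambda>w\<in>W. w}"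
  proof (intro equalityI subsetI)
    fix \<alpha> assume "\<alpha> \<in> group_fusion P W W"
    then show "\<alpha> \<in> {\<lambda>w\<in>W. w}" unfolding group_fusion_def using rW by blast
  next
    fix \<alpha> assume "\<alpha> \<in> {\<lambda>w\<in>W. w}"
    then have "\<alpha> = restrict (conj_by P \<one>) W" using rW[OF one_closed] by simp
    moreover have "conj_by P \<one> ` W \<subseteq> W" using conj_W[OF one_closed] by auto
    ultimately show "\<alpha> \<in> group_fusion P W W"
      unfolding group_fusion_def using one_closed by blast
  qed
  then have "p ^ multiplicity p (card (F W W)) = 1" using card by simp
  then have "multiplicity p (card (F W W)) = 0"
    using prime_gt_1_nat[OF prime] power_eq_1_iff[of p] by auto
  \<comment> \<open>\<open>multiplicity p 0\<close> is 0 as well, so the cardinality has to be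
    nonzero before indivisibility by \<open>p\<close> follows.\<close>
  moreover have "F W W \<noteq> {}" using inclusion_morphism[OF W W] by blast
  ultimately have ndvd: "\<not> p dvd card (F W W)"
    using fin prime_elem_multiplicity_eq_zero_iff[OF prime_imp_prime_elem[OF prime]]
    by (metis card_eq_0_iff)
  have WW: "\<gamma> x = x" if \<gamma>: "\<gamma> \<in> F W W" for \<gamma>
  proof -
    obtain z where z: "z \<in> ?Z" "\<gamma> x = z \<otimes> x"
      using second_centre_moved_by_centre[OF x(1) _ W W \<gamma>] inW by blast
    have zP: "z \<in> carrier P" by (rule fusion_centre_carrier[OF z(1)])
    let ?A = "BijGroup W\<lparr>carrier := F W W\<rparr>"
    interpret A: group ?A
      by (rule group.subgroup_imp_group[OF group_BijGroup subgroup_Aut_fusion[OF W]])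
    have sub: "F W W \<subseteq> Bij W"
      using subgroup.subset[OF subgroup_Aut_fusion[OF W]] by (simp add: BijGroup_def)
    have pow: "(\<gamma> [^]\<^bsub>?A\<^esub> (n::nat)) x = z [^] n \<otimes> x" for n
    proof (induction n)
      case 0
      then show ?case using inW xP by (simp add: BijGroup_def)
    next
      case (Suc n)
      let ?\<delta> = "\<gamma> [^]\<^bsub>?A\<^esub> n"
      have \<delta>: "?\<delta> \<in> F W W" using A.nat_pow_closed[of \<gamma> n] \<gamma> by simp
      have zW: "z \<in> W" and xW: "x \<in> W" using z inW by auto
      \<comment> \<open>\<open>\<gamma>\<close> is applied first and \<open>?\<delta>\<close> fixes
        \<open>z\<close>, so the new factor \<open>z\<close> appears in front of the power.\<close>
      have "(\<gamma> [^]\<^bsub>?A\<^esub> Suc n) x = ?\<delta> (\<gamma> x)"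
        using \<delta> \<gamma> sub inW by (simp add: BijGroup_def subset_iff compose_def)
      also have "\<dots> = z \<otimes> (z [^] n \<otimes> x)"
        using z morphism_mult[OF W W \<delta> zW xW] fusion_centre_fixed[OF z(1) W W \<delta> zW] Suc by simp
      also have "\<dots> = z [^] Suc n \<otimes> x"
        using zP xP nat_pow_Suc2[OF zP, of n] by (simp add: m_assoc[symmetric] del: nat_pow_Suc)
      finally show ?case .
    qed
    have "\<gamma> [^]\<^bsub>?A\<^esub> card (F W W) = \<one>\<^bsub>?A\<^esub>"
      using A.pow_order_eq_1[of \<gamma>] \<gamma> by (simp add: order_def)
    then have "z [^] card (F W W) \<otimes> x = x"
      using pow[of "card (F W W)"] inW by (simp add: BijGroup_def)
    then have "z [^] card (F W W) = \<one>" using zP xP by simp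
    then have o1: "ord z dvd card (F W W)" using pow_eq_id[OF zP] by simp
    obtain n where n: "order P = p ^ n" using p_group by (auto simp: finite_p_group_def)
    have "ord z dvd p ^ n" using ord_dvd_group_order[OF zP] n by simp
    then obtain k where "ord z = p ^ k" using divides_primepow_nat[OF prime] by blast
    moreover from this have "k = 0"
      using o1 ndvd by (cases k) (auto dest: dvd_mult_left)
    ultimately have "z [^] (1::nat) = \<one>" using pow_eq_id[OF zP, of 1] by simp
    then show ?thesis using z zP xP by simp
  qed
  \<comment> \<open>\<open>Q\<close> contains \<open>x\<close> but perhaps not all of
    \<open>?Z\<close>. Extending \<open>\<phi>\<close> over \<open>?Z\<close> gives a morphism that
    can be restricted to \<open>W\<close>, and by \<open>WZ\<close> the restriction is an
    automorphism of \<open>W\<close>.\<close>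
  let ?Q = "generate P (?Z \<union> Q)" and ?R = "generate P (?Z \<union> R)"
  have sub: "subgroup (generate P (?Z \<union> S)) P" if "subgroup S P" for S
    using that subgroup.subset subgroup_fusion_centre by (intro generate_is_subgroup) blast
  obtain \<phi>1 where \<phi>1: "\<phi>1 \<in> F ?Q ?R" "\<And>y. y \<in> Q \<Longrightarrow> \<phi>1 y = \<phi> y"
    using fusion_centre_extend_all[OF Q R \<phi>] by blast
  have WQ: "W \<subseteq> ?Q" unfolding W_def by (rule mono_generate) (use x(2) in auto)
  have r: "restrict \<phi>1 W \<in> F W ?R" by (rule restrict_morphism[OF sub[OF Q] sub[OF R] \<phi>1(1) W WQ])
  then have "restrict \<phi>1 W \<in> F W W"
    using image_morphism[OF W sub[OF R] r] WZ[OF sub[OF R] r] by simp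
  then have "\<phi>1 x = x" using WW inW by fastforce
  then show ?thesis using \<phi>1(2)[OF x(2)] by simp
qed

theorem second_centre_eq_centre:
  assumes "Factorial_Ring.prime p" "perfect_fusion p P F"
  shows "fusion_second_centre P F = fusion_centre P F"
proof
  show "fusion_second_centre P F \<subseteq> fusion_centre P F"
  proof
    fix x assume x: "x \<in> fusion_second_centre P F"
    show "x \<in> fusion_centre P F"
    proof (rule fusion_centreI)
      show "\<phi> x = x" if "subgroup Q P" "subgroup R P" "\<phi> \<in> F Q R" "x \<in> Q" for Q R \<phi>
        using second_centre_fixed[OF assms x] that by blast
    qed (use second_centre_carrier[OF x] second_centre_commute[OF assms x] in auto)
  qed
qed (rule fusion_centre_subset_second_centre)

end

theorem propositionF:
  fixes p :: nat and P :: "('a, 'm) monoid_scheme"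
    and F :: "'a set \<Rightarrow> 'a set \<Rightarrow> ('a \<Rightarrow> 'a) set"
  assumes "Factorial_Ring.prime p"
    and "saturated_fusion_system p P F"
    and "perfect_fusion p P F"
  shows "fusion_second_centre P F = fusion_centre P F"
  by (rule saturated_fusion_system.second_centre_eq_centre[OF assms(2,1,3)])

end
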